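(* For any integer $\gamma \geq 0$ and any $\gamma$-multiprojection algebra $\mathcal{M}$ with operations $\star_a$ and endomorphisms $\pi_a$, $a \in [\gamma]$, the vector space $\mathcal{M}$ endowed with the bilinear operations $\dashv_a$, $\vdash_a$, $a \in [\gamma]$, defined for all $x, y \in \mathcal{M}$ by $$x \dashv_a y := x \star_a \pi_a(y), \qquad x \vdash_a y := \pi_a(x) \star_a y,$$ is a $\gamma$-pluriassociative algebra.
   Context: The ground field has characteristic zero; $[\gamma]=\{1,\dots,\gamma\}$ and $a \uparrow a' := \max(a,a')$. A $\gamma$-multiassociative algebra is a vector space $\mathcal{M}$ with bilinear operations $\star_a$, $a \in [\gamma]$, such that for all $x,y,z \in \mathcal{M}$, all $b \in [\gamma]$ and all $a, a', a'', a''' \in [\gamma]$ that are $\leq b$: $(x \star_a y) \star_b z = (x \star_b y) \star_{a'} z = x \star_{a''} (y \star_b z) = x \star_b (y \star_{a'''} z)$. A morphism of $\gamma$-multiassociative algebras is a linear map commuting with all operations $\star_a$. A $\gamma$-multiprojection algebra is a $\gamma$-multiassociative algebra $\mathcal{M}$ endowed with ($\gamma$-multiassociative algebra) endomorphisms $\pi_a : \mathcal{M} \to \mathcal{M}$, $a \in [\gamma]$, satisfying $\pi_a \circ \pi_{a'} = \pi_{a \uparrow a'}$ for all $a, a' \in [\gamma]$. A $\gamma$-pluriassociative algebra is a vector space with bilinear operations $\dashv_a, \vdash_a$, $a \in [\gamma]$, such that for all elements $x,y,z$ and all $a, a' \in [\gamma]$: $(x \vdash_{a'} y) \dashv_a z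 = x \vdash_{a'} (y \dashv_a z)$; $(x \dashv_{a\uparrow a'} y) \dashv_a z = x \dashv_a (y \vdash_{a'} z)$; $(x \dashv_{a'} y) \vdash_a z = x \vdash_a (y \vdash_{a \uparrow a'} z)$; $(x \dashv_a y) \dashv_{a\uparrow a'} z = x \dashv_a (y \dashv_{a'} z)$; $(x \vdash_{a'} y) \vdash_a z = x \vdash_{a \uparrow a'} (y \vdash_a z)$. *)

theory Defs
  imports Complex_Main
begin

text \<open>
  Vector spaces are whole types \<open>'v\<close> with an explicit scalar multiplication satisfying the library
  locale \<^locale>\<open>vector_space\<close>. A family of operations indexed by \<open>{1..\<gamma>}\<close> is a function on
  \<^typ>\<open>nat\<close>; its values outside \<open>{1..\<gamma>}\<close> are unconstrained and irrelevant.
\<close>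

definition bilinear_op :: "('k::field \<Rightarrow> 'v::ab_group_add \<Rightarrow> 'v) \<Rightarrow> ('v \<Rightarrow> 'v \<Rightarrow> 'v) \<Rightarrow> bool"
  where "bilinear_op scale f \<longleftrightarrow>
    (\<forall>x. Vector_Spaces.linear scale scale (\<lambda>y. f x y)) \<and>
    (\<forall>y. Vector_Spaces.linear scale scale (\<lambda>x. f x y))"

locale multiassociative_algebra = vector_space scale
  for scale :: "'k::field_char_0 \<Rightarrow> 'v::ab_group_add \<Rightarrow> 'v" +
  fixes \<gamma> :: nat
    and star :: "nat \<Rightarrow> 'v \<Rightarrow> 'v \<Rightarrow> 'v"
  assumes star_bilinear: "a \<in> {1..\<gamma>} \<Longrightarrow> bilinear_op scale (star a)"
    and star_assoc:
      "\<lbrakk>b \<in> {1..\<gamma>}; a \<in> {1..\<gamma>}; a' \<in> {1..\<gamma>}; a'' \<in> {1..\<gamma>}; a''' \<in> {1..\<gamma>};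
        a \<le> b; a' \<le> b; a'' \<le> b; a''' \<le> b\<rbrakk> \<Longrightarrow>
        star b (star a x y) z = star a' (star b x y) z \<and>
        star a' (star b x y) z = star a'' x (star b y z) \<and>
        star a'' x (star b y z) = star b x (star a''' y z)"

locale multiassociative_hom =
  dom: multiassociative_algebra scale1 \<gamma> star1 + cod: multiassociative_algebra scale2 \<gamma> star2
  for scale1 :: "'k::field_char_0 \<Rightarrow> 'v::ab_group_add \<Rightarrow> 'v"
    and scale2 :: "'k \<Rightarrow> 'w::ab_group_add \<Rightarrow> 'w"
    and \<gamma> :: nat
    and star1 :: "nat \<Rightarrow> 'v \<Rightarrow> 'v \<Rightarrow> 'v"
    and star2 :: "nat \<Rightarrow> 'w \<Rightarrow> 'w \<Rightarrow> 'w" +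
  fixes f :: "'v \<Rightarrow> 'w"
  assumes hom_linear: "Vector_Spaces.linear scale1 scale2 f"
    and hom_star: "a \<in> {1..\<gamma>} \<Longrightarrow> f (star1 a x y) = star2 a (f x) (f y)"

locale multiprojection_algebra = multiassociative_algebra scale \<gamma> star
  for scale :: "'k::field_char_0 \<Rightarrow> 'v::ab_group_add \<Rightarrow> 'v"
    and \<gamma> :: nat
    and star :: "nat \<Rightarrow> 'v \<Rightarrow> 'v \<Rightarrow> 'v" +
  fixes \<pi> :: "nat \<Rightarrow> 'v \<Rightarrow> 'v"
  assumes proj_endo: "a \<in> {1..\<gamma>} \<Longrightarrow> multiassociative_hom scale scale \<gamma> star star (\<pi> a)"
    and proj_comp: "\<lbrakk>a \<in> {1..\<gamma>}; a' \<in> {1..\<gamma>}\<rbrakk> \<Longrightarrow> \<pi> a \<circ> \<pi> a' = \<pi> (max a a')"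

text \<open>
  \<open>left a x y\<close> is $x \dashv_a y$ and \<open>right a x y\<close> is $x \vdash_a y$.
\<close>

locale pluriassociative_algebra = vector_space scale
  for scale :: "'k::field_char_0 \<Rightarrow> 'v::ab_group_add \<Rightarrow> 'v" +
  fixes \<gamma> :: nat
    and left :: "nat \<Rightarrow> 'v \<Rightarrow> 'v \<Rightarrow> 'v"
    and right :: "nat \<Rightarrow> 'v \<Rightarrow> 'v \<Rightarrow> 'v"
  assumes left_bilinear: "a \<in> {1..\<gamma>} \<Longrightarrow> bilinear_op scale (left a)"
    and right_bilinear: "a \<in> {1..\<gamma>} \<Longrightarrow> bilinear_op scale (right a)"
    and right_left: "\<lbrakk>a \<in> {1..\<gamma>}; a' \<in> {1..\<gamma>}\<rbrakk> \<Longrightarrow>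
      left a (right a' x y) z = right a' x (left a y z)"
    and left_left_right: "\<lbrakk>a \<in> {1..\<gamma>}; a' \<in> {1..\<gamma>}\<rbrakk> \<Longrightarrow>
      left a (left (max a a') x y) z = left a x (right a' y z)"
    and left_right_right: "\<lbrakk>a \<in> {1..\<gamma>}; a' \<in> {1..\<gamma>}\<rbrakk> \<Longrightarrow>
      right a (left a' x y) z = right a x (right (max a a') y z)"
    and left_left: "\<lbrakk>a \<in> {1..\<gamma>}; a' \<in> {1..\<gamma>}\<rbrakk> \<Longrightarrow>
      left (max a a') (left a x y) z = left a x (left a' y z)"
    and right_right: "\<lbrakk>a \<in> {1..\<gamma>}; a' \<in> {1..\<gamma>}\<rbrakk> \<Longrightarrow>
      right a (right a' x y) z = right (max a a') x (right a y z)"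

end

theory Submission imports Defs begin

text \<open>
  In a multiassociative algebra, a bracketed product of three elements depends only on the larger of
  its two operation indices, not on the bracketing. Since the maps \<open>\<pi> a\<close> are endomorphisms composing
  via the maximum, in each pluriassociative relation both sides carry the same projections on their
  arguments, and the larger index is the same on both sides.
\<close>

text \<open>With its distinguished index \<open>b\<close> taken to be the common maximum,
  \<open>star_assoc\<close> equates four products: each bracketing, with the maximum as either the
  inner or the outer index. Each side of the claim is one of these four.\<close>

lemma (in multiassociative_algebra) star_assoc_max:
  assumes "a \<in> {1..\<gamma>}" "b \<in> {1..\<gamma>}" "c \<in> {1..\<gamma>}" "d \<in> {1..\<gamma>}"
    and "max a b = max c d"
  shows "star b (star a x y) z = star c x (star d y z)"
proof -
  define m where "m = max a b"
  have m: "m \<in> {1..\<gamma>}" "a \<le> m" "b \<le> m" "c \<le> m" "d \<le> m"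
    using assms by (auto simp: m_def max_def)
  obtain w where w: "star m (star a x y) z = w" "star b (star m x y) z = w"
    "star c x (star m y z) = w" "star m x (star d y z) = w"
    using star_assoc[OF m(1) assms(1,2,3,4) m(2-5), of x y z] by auto
  \<comment> \<open>The maximum is attained in each index pair; which member attains it selects the
    matching product among the four equal to \<open>w\<close>.\<close>
  have "a = m \<or> b = m" "c = m \<or> d = m"
    using assms(5) by (auto simp: m_def max_def)
  then have "star b (star a x y) z = w" "star c x (star d y z) = w"
    using w by auto
  then show ?thesis
    by simp
qed

lemma bilinear_op_compose_right:
  assumes f: "bilinear_op scale f" and p: "Vector_Spaces.linear scale scale p"
  shows "bilinear_op scale (\<lambda>x y. f x (p y))"
proof -
  have "Vector_Spaces.linear scale scale (\<lambda>y. f x (p y))" for x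
    using Vector_Spaces.linear_compose[OF p, of scale "f x"] f
    by (simp add: bilinear_op_def o_def)
  then show ?thesis
    using f by (simp add: bilinear_op_def)
qed

lemma bilinear_op_compose_left:
  assumes f: "bilinear_op scale f" and p: "Vector_Spaces.linear scale scale p"
  shows "bilinear_op scale (\<lambda>x y. f (p x) y)"
proof -
  have "Vector_Spaces.linear scale scale (\<lambda>x. f (p x) y)" for y
    using Vector_Spaces.linear_compose[OF p, of scale "\<lambda>x. f x y"] f
    by (simp add: bilinear_op_def o_def)
  then show ?thesis
    using f by (simp add: bilinear_op_def)
qed

theorem theorem3p3p2:
  fixes scale :: "'k::field_char_0 \<Rightarrow> 'v::ab_group_add \<Rightarrow> 'v"
    and \<gamma> :: nat
    and star :: "nat \<Rightarrow> 'v \<Rightarrow> 'v \<Rightarrow> 'v"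
    and \<pi> :: "nat \<Rightarrow> 'v \<Rightarrow> 'v"
  assumes "multiprojection_algebra scale \<gamma> star \<pi>"
  shows "pluriassociative_algebra scale \<gamma>
    (\<lambda>a x y. star a x (\<pi> a y))
    (\<lambda>a x y. star a (\<pi> a x) y)"
proof -
  interpret multiprojection_algebra scale \<gamma> star \<pi>
    by (fact assms)
  have lin: "Vector_Spaces.linear scale scale (\<pi> a)" if "a \<in> {1..\<gamma>}" for a
    using multiassociative_hom.hom_linear[OF proj_endo[OF that]] .
  have hom: "\<pi> a (star b x y) = star b (\<pi> a x) (\<pi> a y)"
    if "a \<in> {1..\<gamma>}" "b \<in> {1..\<gamma>}" for a b x y
    using multiassociative_hom.hom_star[OF proj_endo[OF that(1)] that(2)] .
  have comp: "\<pi> a (\<pi> b x) = \<pi> (max a b) x"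
    if "a \<in> {1..\<gamma>}" "b \<in> {1..\<gamma>}" for a b x
    using proj_comp[OF that] by (simp add: fun_eq_iff)
  have max_mem: "max a b \<in> {1..\<gamma>}" if "a \<in> {1..\<gamma>}" "b \<in> {1..\<gamma>}" for a b
    using that by (simp add: max_def)
  show ?thesis
  proof (unfold_locales, goal_cases)
    case (1 a)
    show ?case
      by (rule bilinear_op_compose_right[OF star_bilinear[OF 1] lin[OF 1]])
  next
    case (2 a)
    show ?case
      by (rule bilinear_op_compose_left[OF star_bilinear[OF 2] lin[OF 2]])
  next
    \<comment> \<open>No projection is applied to a product here, and both sides use the same two
      indices.\<close>
    case (3 a a' x y z)
    then show ?case
      by (intro star_assoc_max) auto
  next
    \<comment> \<open>On the right, \<open>hom\<close> distributes \<open>\<pi> a\<close> over the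
      inner product and \<open>comp\<close> merges it with \<open>\<pi> a'\<close>. Both sides then
      multiply \<open>x\<close>, \<open>\<pi> (max a a') y\<close> and \<open>\<pi> a z\<close>,
      with larger index \<open>max a a'\<close>.\<close>
    case (4 a a' x y z)
    then show ?case
      by (simp only: hom comp, intro star_assoc_max max_mem) auto
  next
    case (5 a a' x y z)
    then show ?case
      by (simp only: hom comp, intro star_assoc_max max_mem) auto
  next
    case (6 a a' x y z)
    then show ?case
      by (simp only: hom comp, intro star_assoc_max max_mem) auto
  next
    \<comment> \<open>Here the product under \<open>\<pi> a\<close> is on the left; the common
      factors become \<open>\<pi> (max a a') x\<close>, \<open>\<pi> a y\<close> and
      \<open>z\<close>.\<close>
    case (7 a a' x y z)
    then show ?case
      by (simp only: hom comp, intro star_assoc_max max_mem) auto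
  qed
qed

end
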